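(* Let $\mathbb{F}=\mathbb{R}$ or $\mathbb{C}$, let $v_1,\ldots,v_n\in\mathbb{F}^n$, and let $M=M(v_1,\ldots,v_n)$ be the $n\times n$ matrix with these vectors as columns. (i) If $\mathbb{F}=\mathbb{R}$, then $|\det M|=\mathcal{V}_n(v_1,\ldots,v_n)$. (ii) If $\mathbb{F}=\mathbb{C}$, then $|\det M|^2=\mathcal{V}_{2n}(v_1,\mathrm{i}v_1,\ldots,v_n,\mathrm{i}v_n)$.
   Context: $\langle\cdot,\cdot\rangle$ is the canonical inner product on $\mathbb{R}^n$ or the canonical Hermitian product on $\mathbb{C}^n$ (conjugate-linear in the first entry). $\langle\cdot,\cdot\rangle_{\mathbb{R}}=\langle\cdot,\cdot\rangle$ if $\mathbb{F}=\mathbb{R}$, and $\langle\cdot,\cdot\rangle_{\mathbb{R}}=\operatorname{Re}\langle\cdot,\cdot\rangle$ if $\mathbb{F}=\mathbb{C}$ (the Euclidean inner product of the underlying real space $(\mathbb{C}^n)_{\mathbb{R}}=\mathbb{R}^{2n}$). For vectors $v_1,\ldots,v_p\in\mathbb{F}^n$, $\mathcal{V}_p(v_1,\ldots,v_p)$ (also written $\mathcal{V}(v_1,\ldots,v_p)$) is the real $p$-dimensional volume of the parallelotope $\{\sum_{j=1}^p t_jv_j:0\le t_j\le1\}$, defined recursively by $\mathcal{V}(v_1)=\|v_1\|$ and $\mathcal{V}(v_1,\ldots,v_k)=\mathcal{V}(v_1,\ldots,v_{k-1})\cdot\|u_k\|$ for $2\le k\le p$, where $u_k=v_k-\sum_{j=1}^{k-1}c_jv_j$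 with $c_j\in\mathbb{R}$ such that $\langle v_j,u_k\rangle_{\mathbb{R}}=0$ for all $j<k$. *)

theory Defs
  imports "HOL-Analysis.Analysis"
begin

text \<open>
  The class \<^class>\<open>euclidean_space\<close> covers both \<^typ>\<open>real ^ 'n\<close> and \<^typ>\<open>complex ^ 'n\<close>; on the latter
  \<open>\<bullet>\<close> is the inner product of the underlying real space, i.e. the real part of the canonical
  Hermitian product.
\<close>

lemma inner_complex_vec_eq_Re_hermitian:
  fixes v w :: "complex ^ 'n"
  shows "v \<bullet> w = Re (\<Sum>i\<in>UNIV. cnj (v $ i) * w $ i)"
  by (simp add: inner_vec_def inner_complex_def)

definition is_orth_part :: "'a::euclidean_space list \<Rightarrow> 'a \<Rightarrow> 'a \<Rightarrow> bool" where
  "is_orth_part vs v u \<longleftrightarrow>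
     (\<exists>c :: nat \<Rightarrow> real. u = v - (\<Sum>j<length vs. c j *\<^sub>R (vs ! j))) \<and>
     (\<forall>j<length vs. (vs ! j) \<bullet> u = 0)"

text \<open>
  If the vectors in \<open>vs\<close> are linearly dependent, the coefficients \<open>c\<close> are not unique, but \<open>u\<close> is.
\<close>

lemma ex1_is_orth_part: "\<exists>!u. is_orth_part vs v u"
proof -
  have sp: "(\<Sum>j<length vs. c j *\<^sub>R (vs ! j)) \<in> span (set vs)" for c :: "nat \<Rightarrow> real"
    by (intro span_sum span_scale span_base) auto
  have orth: "x \<bullet> u = 0" if "\<forall>j<length vs. (vs ! j) \<bullet> u = 0" "x \<in> span (set vs)" for x u
  proof -
    have "orthogonal u x"
      by (rule orthogonal_to_span[OF that(2)])
        (use that(1) in \<open>auto simp: in_set_conv_nth orthogonal_def inner_commute\<close>)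
    then show ?thesis by (simp add: orthogonal_def inner_commute)
  qed
  obtain y z where y: "y \<in> span (set vs)"
    and z: "\<And>w. w \<in> span (set vs) \<Longrightarrow> orthogonal z w" and v: "v = y + z"
    using orthogonal_subspace_decomp_exists by blast
  have comb: "\<exists>c :: nat \<Rightarrow> real. x = (\<Sum>j<length ws. c j *\<^sub>R (ws ! j))"
    if "x \<in> span (set ws)" for x and ws :: "'a list"
    using that
  proof (induction ws arbitrary: x)
    case Nil
    then show ?case by simp
  next
    case (Cons w ws)
    then obtain k where "x - k *\<^sub>R w \<in> span (set ws)"
      by (auto simp: span_insert)
    with Cons.IH obtain c where "x - k *\<^sub>R w = (\<Sum>j<length ws. c j *\<^sub>R (ws ! j))" by blast
    then have "x = k *\<^sub>R w + (\<Sum>j<length ws. c j *\<^sub>R (ws ! j))"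
      by (simp add: algebra_simps)
    then have "x = (\<Sum>j<length (w # ws). (case j of 0 \<Rightarrow> k | Suc i \<Rightarrow> c i) *\<^sub>R ((w # ws) ! j))"
      by (simp add: sum.lessThan_Suc_shift del: sum.lessThan_Suc)
    then show ?case by blast
  qed
  show ?thesis
  proof (rule ex1I)
    obtain c :: "nat \<Rightarrow> real" where "y = (\<Sum>j<length vs. c j *\<^sub>R (vs ! j))"
      using comb[OF y] by blast
    with v have "z = v - (\<Sum>j<length vs. c j *\<^sub>R (vs ! j))"
      by simp
    moreover have "\<forall>j<length vs. (vs ! j) \<bullet> z = 0"
      using z[OF span_base] by (simp add: orthogonal_def inner_commute[of _ z])
    ultimately show "is_orth_part vs v z"
      unfolding is_orth_part_def by blast
  next
    fix u assume "is_orth_part vs v u"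
    then obtain c where u: "u = v - (\<Sum>j<length vs. c j *\<^sub>R (vs ! j))"
      and 0: "\<forall>j<length vs. (vs ! j) \<bullet> u = 0"
      unfolding is_orth_part_def by blast
    have d: "u - z \<in> span (set vs)"
      using span_diff[OF y sp[of c]] by (simp add: u v)
    have "(u - z) \<bullet> u = 0" "(u - z) \<bullet> z = 0"
      using orth[OF 0 d] z[OF d] by (auto simp: orthogonal_def inner_commute)
    then have "(u - z) \<bullet> (u - z) = 0"
      by (simp add: inner_diff_right)
    then show "u = z" by simp
  qed
qed

definition orth_part :: "'a::euclidean_space list \<Rightarrow> 'a \<Rightarrow> 'a" where
  "orth_part vs v = (THE u. is_orth_part vs v u)"

text \<open>The value on the empty list is a convention; the recursion starts with one vector.\<close>

fun parallelotope_volume :: "'a::euclidean_space list \<Rightarrow> real" where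
  "parallelotope_volume [] = 1"
| "parallelotope_volume [v] = norm v"
| "parallelotope_volume (v # w # vs) =
     parallelotope_volume (butlast (v # w # vs)) *
     norm (orth_part (butlast (v # w # vs)) (last (v # w # vs)))"

definition matrix_of_columns :: "('m \<Rightarrow> 'a ^ 'n) \<Rightarrow> 'a ^ 'm ^ 'n" where
  "matrix_of_columns v = (\<chi> i j. v j $ i)"

lemma column_matrix_of_columns: "column j (matrix_of_columns v) = v j"
  by (simp add: column_def matrix_of_columns_def vec_eq_iff)

end

theory Submission imports Defs begin

text \<open>
  Both halves are one computation with a field involution \<open>h\<close> (the identity on the reals, complex
  conjugation on the complex numbers) and its form \<open>\<Sum>i. h (x $ i) * y $ i\<close>. Let \<open>u k\<close> be the part
  of \<open>v k\<close> orthogonal, for this form, to the vectors that precede it in the list. Each \<open>u k\<close> arises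
  from \<open>v k\<close> by subtracting a combination of earlier columns, so the determinant \<open>d\<close> of the columns
  is unchanged; and since the \<open>u k\<close> are pairwise orthogonal, their Gram matrix is diagonal, which
  gives \<open>h d * d = (\<Prod>k. \<parallel>u k\<parallel>\<^sup>2)\<close> (lemma \<open>det_eq_prod_orthogonal_parts\<close>).

  In the real case the \<open>u k\<close> are the orthogonal parts in the definition of the volume, so the
  right-hand side is the square of the volume. In the complex case the list has two vectors for each
  index. The real span of the pairs \<open>w j, \<i> *s w j\<close> is the complex span of the \<open>w j\<close>, and real
  orthogonality to both members of a pair is Hermitian orthogonality to \<open>w j\<close>; hence the real
  orthogonal part of \<open>w k\<close> is again the Hermitian one, \<open>u k\<close>. As \<open>u k\<close> and \<open>\<i> *s u k\<close> are orthogonal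
  over the reals, the orthogonal part of \<open>\<i> *s w k\<close>, taken with \<open>w k\<close> also in the list, is
  \<open>\<i> *s u k\<close> (lemma \<open>orth_part_i_scale\<close>). Each index thus contributes \<open>\<parallel>u k\<parallel>\<^sup>2\<close> to the volume,
  which is therefore \<open>h d * d\<close> itself and not its square root.
\<close>

section \<open>Sesquilinear forms and the squared modulus of a determinant\<close>

locale conjugation =
  fixes h :: "'a::field \<Rightarrow> 'a"
  assumes h_add: "h (x + y) = h x + h y"
    and h_mult: "h (x * y) = h x * h y"
    and h_one: "h 1 = 1"
    and h_h: "h (h x) = x"
begin

lemma h_zero: "h 0 = 0"
  by (metis h_add add_0_right add_cancel_right_right)

lemma h_minus: "h (- x) = - h x"
  using h_add[of x "- x"] by (simp add: h_zero add_eq_0_iff)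

lemma h_sum: "h (sum f A) = (\<Sum>x\<in>A. h (f x))"
  by (induction A rule: infinite_finite_induct) (simp_all add: h_zero h_add)

lemma h_prod: "h (prod f A) = (\<Prod>x\<in>A. h (f x))"
  by (induction A rule: infinite_finite_induct) (simp_all add: h_one h_mult)

definition herm :: "'a ^ 'm \<Rightarrow> 'a ^ 'm \<Rightarrow> 'a" where
  "herm x y = (\<Sum>i\<in>UNIV. h (x $ i) * y $ i)"

lemma herm_commute: "herm y x = h (herm x y)"
  by (simp add: herm_def h_sum h_mult h_h mult.commute)

lemma subspace_herm_zero: "vec.subspace {x. herm x y = 0}"
  by (simp add: vec.subspace_def herm_def h_zero h_add h_mult distrib_right sum.distrib
      mult.assoc flip: sum_distrib_left)

lemma herm_eq_0_if_in_span:
  assumes "x \<in> vec.span S" and "\<And>s. s \<in> S \<Longrightarrow> herm s y = 0"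
  shows "herm x y = 0"
  using vec.span_minimal[OF _ subspace_herm_zero, of S y] assms by auto

lemma det_conjugate:
  fixes A :: "'a ^ 'm ^ 'm"
  shows "det (\<chi> i j. h (A $ i $ j)) = h (det A)"
proof -
  have "h (of_int (sign p)) = of_int (sign p)" for p :: "'m \<Rightarrow> 'm"
    by (simp add: sign_def h_one h_minus)
  then show ?thesis
    by (simp add: det_def h_sum h_mult h_prod)
qed

text \<open>The Gram matrix \<open>U\<^sup>* U\<close> of the columns is diagonal, and \<open>det U\<^sup>*\<close> is the conjugate of \<open>det U\<close>.\<close>

lemma det_orthogonal_columns:
  assumes "\<And>i j. i \<noteq> j \<Longrightarrow> herm (u i) (u j) = 0"
  shows "h (det (matrix_of_columns u)) * det (matrix_of_columns u) = (\<Prod>j\<in>UNIV. herm (u j) (u j))"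
proof -
  let ?U = "matrix_of_columns u" and ?C = "transpose (\<chi> i j. h (matrix_of_columns u $ i $ j))"
  have entry: "(?C ** ?U) $ i $ j = herm (u i) (u j)" for i j
    by (simp add: matrix_matrix_mult_def transpose_def matrix_of_columns_def herm_def)
  have "h (det ?U) * det ?U = det (?C ** ?U)"
    by (simp add: det_mul det_conjugate)
  also have "\<dots> = (\<Prod>j\<in>UNIV. (?C ** ?U) $ j $ j)"
    by (rule det_diagonal) (simp add: entry assms)
  finally show ?thesis by (simp add: entry)
qed

end

section \<open>Orthogonalisation along a list of indices\<close>

lemma det_add_span_column:
  fixes v :: "'n::finite \<Rightarrow> 'a::field ^ 'n"
  assumes "x \<in> vec.span (v ` (- {k}))"
  shows "det (matrix_of_columns (v(k := v k + x))) = det (matrix_of_columns v)"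
proof -
  let ?A = "transpose (matrix_of_columns v)"
  have row: "row j ?A = v j" for j
    by (simp add: row_transpose column_matrix_of_columns)
  have "{row j ?A |j. j \<noteq> k} = v ` (- {k})"
    by (auto simp: row_transpose column_matrix_of_columns)
  with det_row_span[of x ?A k] assms
  have "det (\<chi> j. if j = k then row k ?A + x else row j ?A) = det ?A"
    by simp
  also have "(\<chi> j. if j = k then row k ?A + x else row j ?A) =
      transpose (matrix_of_columns (v(k := v k + x)))"
    by (simp add: row_transpose column_matrix_of_columns vec_eq_iff)
      (simp add: transpose_def matrix_of_columns_def)
  finally show ?thesis by simp
qed

text \<open>
  The columns are replaced from the last index of the list to the first. In this order the earlier
  columns are still the original ones when column \<open>k\<close> is changed, so the span in the hypothesis
  consists of columns of the current matrix.
\<close>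

lemma det_gram_schmidt:
  fixes u v :: "'n::finite \<Rightarrow> 'a::field ^ 'n"
  assumes "distinct js" and "set js = UNIV"
    and span: "\<And>ks k ls. js = ks @ k # ls \<Longrightarrow> v k - u k \<in> vec.span (v ` set ks)"
  shows "det (matrix_of_columns u) = det (matrix_of_columns v)"
proof -
  have "det (matrix_of_columns (\<lambda>j. if j \<in> set ls then u j else v j)) = det (matrix_of_columns v)"
    if "js = ks @ ls" for ks ls
    using that
  proof (induction ls arbitrary: ks)
    case Nil
    then show ?case by simp
  next
    case (Cons k ls)
    define f where "f = (\<lambda>j. if j \<in> set ls then u j else v j)"
    have k: "k \<notin> set ls" and ks: "k \<notin> set ks" "set ks \<inter> set ls = {}"
      using Cons.prems assms(1) by auto
    have "v ` set ks \<subseteq> f ` (- {k})"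
      using ks by (auto simp: f_def intro!: rev_image_eqI)
    moreover have "u k - v k \<in> vec.span (v ` set ks)"
      using vec.span_neg[OF span[OF Cons.prems]] by simp
    ultimately have "u k - v k \<in> vec.span (f ` (- {k}))"
      using vec.span_mono by blast
    from det_add_span_column[OF this]
    have "det (matrix_of_columns (f(k := u k))) = det (matrix_of_columns f)"
      using k by (simp add: f_def)
    also have "f(k := u k) = (\<lambda>j. if j \<in> set (k # ls) then u j else v j)"
      by (auto simp: f_def)
    also have "det (matrix_of_columns f) = det (matrix_of_columns v)"
      unfolding f_def by (rule Cons.IH[of "ks @ [k]"]) (simp add: Cons.prems)
    finally show ?case .
  qed
  from this[of "[]" js] show ?thesis
    using assms(2) by simp
qed

text \<open>
  The form is only assumed to vanish between an original vector and a later \<open>u k\<close>. Pairwise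
  orthogonality of the \<open>u k\<close> follows, since an earlier \<open>u i\<close> is a combination of original vectors
  that precede \<open>k\<close>.
\<close>

lemma (in conjugation) det_eq_prod_orthogonal_parts:
  fixes u v :: "'n::finite \<Rightarrow> 'a ^ 'n"
  assumes js: "distinct js" "set js = UNIV"
    and span: "\<And>ks k ls. js = ks @ k # ls \<Longrightarrow> v k - u k \<in> vec.span (v ` set ks)"
    and orth: "\<And>ks k ls i. js = ks @ k # ls \<Longrightarrow> i \<in> set ks \<Longrightarrow> herm (v i) (u k) = 0"
  shows "h (det (matrix_of_columns v)) * det (matrix_of_columns v) = (\<Prod>j\<in>UNIV. herm (u j) (u j))"
proof -
  have earlier: "herm (u i) (u k) = 0" if k: "js = ks @ k # ls" and "i \<in> set ks" for ks k ls i
  proof -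
    from \<open>i \<in> set ks\<close> obtain ks1 ks2 where ks: "ks = ks1 @ i # ks2"
      by (meson split_list)
    have "v i - u i \<in> vec.span (v ` set ks1)"
      using span[of ks1 i] k ks by simp
    then have "v i - u i \<in> vec.span (v ` set ks)"
      using vec.span_mono[of "v ` set ks1" "v ` set ks"] ks by auto
    moreover have "v i \<in> vec.span (v ` set ks)"
      using \<open>i \<in> set ks\<close> by (simp add: vec.span_base)
    ultimately have "v i - (v i - u i) \<in> vec.span (v ` set ks)"
      by (rule vec.span_diff[rotated])
    then have "u i \<in> vec.span (v ` set ks)" by simp
    then show ?thesis
      by (rule herm_eq_0_if_in_span) (use orth[OF k] in auto)
  qed
  have "herm (u i) (u k) = 0" if "i \<noteq> k" for i k
  proof -
    obtain ks ls where k: "js = ks @ k # ls"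
      using js(2) by (metis UNIV_I split_list)
    consider "i \<in> set ks" | "i \<in> set ls"
      using js(2) k \<open>i \<noteq> k\<close> by (metis UNIV_I Un_iff set_ConsD set_append)
    then show ?thesis
    proof cases
      case 1
      then show ?thesis using earlier k by blast
    next
      case 2
      then obtain ls1 ls2 where "ls = ls1 @ i # ls2"
        by (meson split_list)
      with k have "herm (u k) (u i) = 0"
        using earlier[of "ks @ k # ls1" i ls2 k] by simp
      then show ?thesis
        by (simp add: herm_commute[of "u i"] h_zero)
    qed
  qed
  then have "h (det (matrix_of_columns u)) * det (matrix_of_columns u) = (\<Prod>j\<in>UNIV. herm (u j) (u j))"
    by (rule det_orthogonal_columns)
  then show ?thesis
    using det_gram_schmidt[OF js span] by simp
qed

section \<open>Orthogonal parts and the volume recursion\<close>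

lemma is_orth_part_orth_part: "is_orth_part vs v (orth_part vs v)"
  unfolding orth_part_def by (rule theI') (rule ex1_is_orth_part)

lemma diff_orth_part_in_span: "v - orth_part vs v \<in> span (set vs)"
proof -
  obtain c :: "nat \<Rightarrow> real" where "orth_part vs v = v - (\<Sum>j<length vs. c j *\<^sub>R (vs ! j))"
    using is_orth_part_orth_part[of vs v] unfolding is_orth_part_def by blast
  then have "v - orth_part vs v = (\<Sum>j<length vs. c j *\<^sub>R (vs ! j))"
    by simp
  then show ?thesis
    by (metis (no_types, lifting) span_sum span_scale span_base nth_mem lessThan_iff)
qed

lemma inner_orth_part: "x \<in> set vs \<Longrightarrow> x \<bullet> orth_part vs v = 0"
  using is_orth_part_orth_part[of vs v] by (auto simp: is_orth_part_def in_set_conv_nth)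

lemma inner_eq_0_if_in_span:
  assumes "x \<in> span S" and "\<And>s. s \<in> S \<Longrightarrow> s \<bullet> y = 0"
  shows "x \<bullet> y = 0"
  using orthogonal_to_span[of x S y] assms by (simp add: orthogonal_def inner_commute)

text \<open>
  Two candidates for the orthogonal part differ by a vector of the span to which both are orthogonal,
  so the difference is orthogonal to itself. This form of the characterisation avoids coefficients.
\<close>

lemma orth_part_eqI:
  assumes "v - u \<in> span (set vs)" and "\<And>x. x \<in> set vs \<Longrightarrow> x \<bullet> u = 0"
  shows "orth_part vs v = u"
proof -
  let ?o = "orth_part vs v"
  have d: "u - ?o \<in> span (set vs)"
    using span_diff[OF diff_orth_part_in_span[of v] assms(1)] by simp
  have "(u - ?o) \<bullet> u = 0" "(u - ?o) \<bullet> ?o = 0"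
    using inner_eq_0_if_in_span[OF d] assms(2) inner_orth_part by blast+
  then have "(u - ?o) \<bullet> (u - ?o) = 0"
    by (simp add: inner_diff_right)
  then show ?thesis by simp
qed

text \<open>
  On a single vector this holds because the orthogonal part with respect to the empty list is the
  vector itself and the volume of the empty list is 1.
\<close>

lemma parallelotope_volume_snoc:
  "parallelotope_volume (vs @ [v]) = parallelotope_volume vs * norm (orth_part vs v)"
proof (cases vs)
  case Nil
  moreover have "orth_part [] v = v"
    by (rule orth_part_eqI) simp_all
  ultimately show ?thesis by simp
next
  case (Cons a as)
  then obtain b bs where "vs @ [v] = a # b # bs"
    by (cases as) auto
  then show ?thesis
    by (metis butlast_snoc last_snoc parallelotope_volume.simps(3))
qed

lemma parallelotope_volume_map:
  assumes "distinct js"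
    and "\<And>ks k ls. js = ks @ k # ls \<Longrightarrow> orth_part (map v ks) (v k) = u k"
  shows "parallelotope_volume (map v js) = (\<Prod>j\<in>set js. norm (u j))"
  using assms
proof (induction js rule: rev_induct)
  case Nil
  then show ?case by simp
next
  case (snoc k js)
  have "parallelotope_volume (map v js) = (\<Prod>j\<in>set js. norm (u j))"
    using snoc.IH snoc.prems by simp
  moreover have "orth_part (map v js) (v k) = u k"
    using snoc.prems(2)[of js k "[]"] by simp
  ultimately show ?case
    using snoc.prems(1) by (simp add: parallelotope_volume_snoc mult.commute)
qed

section \<open>Real and complex linear geometry\<close>

text \<open>
  The second vector of each pair makes the real span of the list equal to the complex span of the
  vectors \<open>w j\<close>.
\<close>

abbreviation with_i_multiples :: "('n \<Rightarrow> complex ^ 'm) \<Rightarrow> 'n list \<Rightarrow> (complex ^ 'm) list" where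
  "with_i_multiples w js \<equiv> concat (map (\<lambda>j. [w j, \<i> *s w j]) js)"

lemma set_with_i_multiples: "set (with_i_multiples w js) = w ` set js \<union> (\<lambda>j. \<i> *s w j) ` set js"
  by auto

interpretation real: conjugation "\<lambda>x::real. x"
  by unfold_locales auto

interpretation complex: conjugation cnj
  by unfold_locales auto

lemma real_herm_eq_inner: "real.herm x y = x \<bullet> y"
  by (simp add: real.herm_def inner_vec_def)

lemma inner_eq_Re_herm: "x \<bullet> y = Re (complex.herm x y)"
  by (simp add: complex.herm_def inner_complex_vec_eq_Re_hermitian)

lemma complex_herm_scale_right: "complex.herm x (c *s y) = c * complex.herm x y"
  by (simp add: complex.herm_def sum_distrib_left ac_simps)

lemma complex_herm_scale_left: "complex.herm (c *s x) y = cnj c * complex.herm x y"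
  by (simp add: complex.herm_def sum_distrib_left ac_simps)

lemma complex_herm_self: "complex.herm x x = of_real ((norm x)\<^sup>2)"
proof -
  have "(norm x)\<^sup>2 = (\<Sum>i\<in>UNIV. (cmod (x $ i))\<^sup>2)"
    by (simp add: norm_vec_def L2_set_def sum_nonneg)
  then show ?thesis
    by (simp only: complex.herm_def of_real_sum complex_norm_square mult.commute)
qed

lemma inner_i_scale_self: "x \<bullet> (\<i> *s x) = 0"
  by (simp add: inner_eq_Re_herm complex_herm_scale_right complex_herm_self)

text \<open>The two real conditions are the vanishing of the real part and of the imaginary part.\<close>

lemma herm_eq_0_iff_inner:
  "complex.herm x y = 0 \<longleftrightarrow> x \<bullet> y = 0 \<and> (\<i> *s x) \<bullet> y = 0"
  by (simp add: inner_eq_Re_herm complex_herm_scale_left complex_eq_iff)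

lemma real_span_subset_complex_span: "span S \<subseteq> vec.span (S :: (complex ^ 'm) set)"
proof (rule span_minimal)
  show "S \<subseteq> vec.span S" by (rule vec.span_superset)
  have "c *\<^sub>R x = complex_of_real c *s x" for c and x :: "complex ^ 'm"
    unfolding vec_eq_iff
    by (simp only: vector_smult_component vector_scaleR_component) (simp add: scaleR_conv_of_real)
  then show "subspace (vec.span S)"
    by (simp add: subspace_def vec.span_zero vec.span_add vec.span_scale)
qed

lemma span_with_i_multiples_subset: "span (set (with_i_multiples w js)) \<subseteq> vec.span (w ` set js)"
proof -
  have "set (with_i_multiples w js) \<subseteq> vec.span (w ` set js)"
    unfolding set_with_i_multiples by (auto intro: vec.span_base vec.span_scale)
  then show ?thesis
    using real_span_subset_complex_span vec.span_minimal[OF _ vec.subspace_span] by blast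
qed

lemma i_scale_in_span_with_i_multiples:
  fixes w :: "'n \<Rightarrow> complex ^ 'm"
  assumes "x \<in> span (set (with_i_multiples w js))"
  shows "\<i> *s x \<in> span (set (with_i_multiples w js))" (is "_ \<in> ?S")
proof -
  have lin: "linear ((*s) \<i> :: complex ^ 'm \<Rightarrow> complex ^ 'm)"
    by (rule linearI) (simp_all add: vec_eq_iff algebra_simps)
  have "\<i> *s y \<in> ?S" if y: "y \<in> set (with_i_multiples w js)" for y
  proof -
    from y obtain j where j: "j \<in> set js" and "y = w j \<or> y = \<i> *s w j"
      by auto
    then have "\<i> *s y = \<i> *s w j \<or> \<i> *s y = - w j"
      by (auto simp: vector_smult_assoc vec_eq_iff)
    moreover have "w j \<in> ?S" "\<i> *s w j \<in> ?S"
      using j by (auto intro: span_base)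
    ultimately show ?thesis
      by (auto simp only: span_neg)
  qed
  then have "((*s) \<i>) ` set (with_i_multiples w js) \<subseteq> ?S"
    by blast
  then have "span (((*s) \<i>) ` set (with_i_multiples w js)) \<subseteq> ?S"
    by (rule span_minimal) simp
  then show ?thesis
    using assms by (auto simp: linear_span_image[OF lin])
qed

lemma herm_orth_part_with_i_multiples:
  assumes "j \<in> set js"
  shows "complex.herm (w j) (orth_part (with_i_multiples w js) x) = 0"
  unfolding herm_eq_0_iff_inner
  by (intro conjI inner_orth_part) (use assms in \<open>auto simp: set_with_i_multiples\<close>)

text \<open>
  Multiplication by \<open>\<i>\<close> preserves both the span of the pairs and Hermitian orthogonality to it. The
  additional vector \<open>x\<close> is the sum of its orthogonal part \<open>u\<close> and a vector of that span, and \<open>u\<close>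
  itself is orthogonal to \<open>\<i> *s u\<close> over the reals.
\<close>

lemma orth_part_i_scale:
  fixes w :: "'n \<Rightarrow> complex ^ 'm"
  shows "orth_part (with_i_multiples w js @ [x]) (\<i> *s x) = \<i> *s orth_part (with_i_multiples w js) x"
proof (rule orth_part_eqI)
  let ?L = "with_i_multiples w js"
  let ?u = "orth_part ?L x"
  have d: "x - ?u \<in> span (set ?L)"
    by (rule diff_orth_part_in_span)
  have "\<i> *s x - \<i> *s ?u \<in> span (set ?L)"
    using i_scale_in_span_with_i_multiples[OF d] by (simp add: vec.scale_right_diff_distrib)
  then show "\<i> *s x - \<i> *s ?u \<in> span (set (?L @ [x]))"
    using span_mono[of "set ?L" "set (?L @ [x])"] by auto
  have 0: "y \<bullet> (\<i> *s ?u) = 0" if "y \<in> set ?L" for y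
    using that herm_orth_part_with_i_multiples[of _ js w x]
    by (auto simp: inner_eq_Re_herm complex_herm_scale_right complex_herm_scale_left)
  have "(x - ?u) \<bullet> (\<i> *s ?u) = 0"
    using inner_eq_0_if_in_span[OF d 0] by blast
  then have "x \<bullet> (\<i> *s ?u) = 0"
    by (simp add: inner_diff_left inner_i_scale_self)
  with 0 show "y \<bullet> (\<i> *s ?u) = 0" if "y \<in> set (?L @ [x])" for y
    using that by auto
qed

lemma norm_i_scale: "norm (\<i> *s x) = norm (x :: complex ^ 'm)"
  by (simp add: norm_vec_def norm_mult)

lemma parallelotope_volume_with_i_multiples:
  assumes "distinct js"
    and "\<And>ks k ls. js = ks @ k # ls \<Longrightarrow> orth_part (with_i_multiples w ks) (w k) = u k"
  shows "parallelotope_volume (with_i_multiples w js) = (\<Prod>j\<in>set js. (norm (u j))\<^sup>2)"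
  using assms
proof (induction js rule: rev_induct)
  case Nil
  then show ?case by simp
next
  case (snoc k js)
  let ?L = "with_i_multiples w js"
  have IH: "parallelotope_volume ?L = (\<Prod>j\<in>set js. (norm (u j))\<^sup>2)"
    using snoc.IH snoc.prems by simp
  have u: "orth_part ?L (w k) = u k"
    using snoc.prems(2)[of js k "[]"] by simp
  have "parallelotope_volume (with_i_multiples w (js @ [k])) =
      parallelotope_volume ((?L @ [w k]) @ [\<i> *s w k])"
    by simp
  also have "\<dots> = parallelotope_volume ?L * (norm (u k))\<^sup>2"
    unfolding parallelotope_volume_snoc orth_part_i_scale u norm_i_scale
    by (simp add: power2_eq_square)
  finally show ?case
    using IH snoc.prems(1) by (simp add: mult.commute)
qed

section \<open>Determinants as volumes\<close>

lemma takeWhile_neq_split: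
  "distinct js \<Longrightarrow> js = ks @ k # ls \<Longrightarrow> takeWhile (\<lambda>i. i \<noteq> k) js = ks"
  by (simp add: takeWhile_append)

text \<open>
  In the next two proofs \<open>takeWhile\<close> serves to write the part of the list before \<open>k\<close> as a function
  of \<open>k\<close>, so that the orthogonal parts form a family indexed by the columns.
\<close>

lemma abs_det_eq_parallelotope_volume:
  fixes v :: "'n::finite \<Rightarrow> real ^ 'n"
  assumes js: "distinct js" "set js = UNIV"
  shows "\<bar>det (matrix_of_columns v)\<bar> = parallelotope_volume (map v js)"
proof -
  define u where "u k = orth_part (map v (takeWhile (\<lambda>i. i \<noteq> k) js)) (v k)" for k
  have u: "orth_part (map v ks) (v k) = u k" if "js = ks @ k # ls" for ks k ls
    by (simp add: u_def takeWhile_neq_split[OF js(1) that])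
  have "det (matrix_of_columns v) * det (matrix_of_columns v) = (\<Prod>j\<in>UNIV. real.herm (u j) (u j))"
  proof (rule real.det_eq_prod_orthogonal_parts[OF js])
    fix ks k ls assume k: "js = ks @ k # ls"
    show "v k - u k \<in> vec.span (v ` set ks)"
      using diff_orth_part_in_span[of "v k" "map v ks"] by (simp add: u[OF k] span_vec_eq)
    show "real.herm (v i) (u k) = 0" if "i \<in> set ks" for i
      using inner_orth_part[of "v i" "map v ks" "v k"] that by (simp add: u[OF k] real_herm_eq_inner)
  qed
  also have "\<dots> = (\<Prod>j\<in>UNIV. norm (u j))\<^sup>2"
    by (simp add: real_herm_eq_inner dot_square_norm prod_power_distrib)
  also have "(\<Prod>j\<in>UNIV. norm (u j)) = parallelotope_volume (map v js)"
    using parallelotope_volume_map[OF js(1) u] js(2) by simp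
  finally have "(det (matrix_of_columns v))\<^sup>2 = (parallelotope_volume (map v js))\<^sup>2"
    by (simp add: power2_eq_square)
  moreover have "parallelotope_volume (map v js) \<ge> 0"
    using parallelotope_volume_map[OF js(1) u] by (simp add: prod_nonneg)
  ultimately show ?thesis
    by (metis abs_of_nonneg power2_eq_iff abs_minus_cancel)
qed

lemma cmod_det_power2_eq_parallelotope_volume:
  fixes w :: "'n::finite \<Rightarrow> complex ^ 'n"
  assumes js: "distinct js" "set js = UNIV"
  shows "(cmod (det (matrix_of_columns w)))\<^sup>2 = parallelotope_volume (with_i_multiples w js)"
proof -
  define u where "u k = orth_part (with_i_multiples w (takeWhile (\<lambda>i. i \<noteq> k) js)) (w k)" for k
  have u: "orth_part (with_i_multiples w ks) (w k) = u k" if "js = ks @ k # ls" for ks k ls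
    by (simp add: u_def takeWhile_neq_split[OF js(1) that])
  have "cnj (det (matrix_of_columns w)) * det (matrix_of_columns w) =
      (\<Prod>j\<in>UNIV. complex.herm (u j) (u j))"
  proof (rule complex.det_eq_prod_orthogonal_parts[OF js])
    fix ks k ls assume k: "js = ks @ k # ls"
    show "w k - u k \<in> vec.span (w ` set ks)"
      using diff_orth_part_in_span[of "w k" "with_i_multiples w ks"]
        span_with_i_multiples_subset[of w ks] by (auto simp: u[OF k])
    show "complex.herm (w i) (u k) = 0" if "i \<in> set ks" for i
      using herm_orth_part_with_i_multiples[OF that, of w "w k"] by (simp add: u[OF k])
  qed
  also have "\<dots> = of_real (\<Prod>j\<in>UNIV. (norm (u j))\<^sup>2)"
    by (simp add: complex_herm_self)
  also have "(\<Prod>j\<in>UNIV. (norm (u j))\<^sup>2) = parallelotope_volume (with_i_multiples w js)"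
    using parallelotope_volume_with_i_multiples[OF js(1) u] js(2) by simp
  also have "cnj (det (matrix_of_columns w)) * det (matrix_of_columns w) =
      of_real ((cmod (det (matrix_of_columns w)))\<^sup>2)"
    by (simp add: complex_norm_square mult.commute del: of_real_power)
  finally show ?thesis
    by (simp only: of_real_eq_iff)
qed

theorem theorem2p2:
  fixes v :: "'n::finite \<Rightarrow> real ^ 'n"
    and w :: "'n \<Rightarrow> complex ^ 'n"
    and js :: "'n list"
  assumes "distinct js" and "set js = UNIV"
  shows "\<bar>det (matrix_of_columns v)\<bar> = parallelotope_volume (map v js) \<and>
         (cmod (det (matrix_of_columns w)))\<^sup>2 =
           parallelotope_volume (concat (map (\<lambda>j. [w j, \<i> *s w j]) js))"
  using abs_det_eq_parallelotope_volume[OF assms] cmod_det_power2_eq_parallelotope_volume[OF assms]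
  by blast

end
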